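(* Let $a<b$ be real numbers, let $r$ be a positive continuous function on the interval $(a,b)$ and let $p$ be a positive integer. Then for all measurable functions $f\ge 0$ on $(a,b)$ such that all integrals below exist and are finite, $$\int_a^b r(x)\left(\int_a^x f(t)\,dt\right)^{p+1}dx\le (b-a)^p\,\sup_{a<x<b}\left(\int_x^b r(t)\,dt\right)\int_a^b (f(x))^{p+1}\,dx.$$
   Context: Standing assumption: all functions are measurable and all the integrals appearing in the inequality (including $\int_x^b r$ and $\int_a^x f$ for $x\in(a,b)$) exist and are finite. The supremum is taken in $[0,+\infty]$, with $0\cdot\infty=0$. *)

theory Defs
  imports "HOL-Analysis.Analysis"
begin

end

theory Submission
  imports Defs "HOL-Real_Asymp.Real_Asymp"
begin

text \<open>
  The primitive \<open>F x = \<integral>\<^sub>a\<^sup>x f\<close> obeys the uniform bound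
  \<open>F x ^ (p + 1) \<le> (b - a) ^ p * \<integral> f ^ (p + 1)\<close> (Jensen), so it only remains to integrate this bound
  against \<open>r\<close>: by monotone convergence, \<open>\<integral> r\<close> over \<open>(a, b)\<close> is the supremum of its integrals over
  \<open>(x, b)\<close>. Working in the extended nonnegative reals covers the case of an infinite supremum.
\<close>

text \<open>Convexity of the power on the nonnegative axis: the graph lies above its tangent at
  \<open>m\<close>. In the induction step, multiplying the previous bound by \<open>y\<close>
  overshoots the new tangent by a nonnegative multiple of \<open>(y - m)\<^sup>2\<close>.\<close>

lemma power_Suc_ge_tangent:
  fixes y m :: real
  assumes "0 \<le> y" "0 \<le> m"
  shows "m ^ Suc n + real (Suc n) * m ^ n * (y - m) \<le> y ^ Suc n"
proof (induction n)
  case 0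
  then show ?case by simp
next
  case (Suc n)
  have "m ^ Suc (Suc n) + real (Suc (Suc n)) * m ^ Suc n * (y - m)
      = y * (m ^ Suc n + real (Suc n) * m ^ n * (y - m)) - real (Suc n) * m ^ n * (y - m)\<^sup>2"
    by (simp add: algebra_simps power2_eq_square)
  also have "\<dots> \<le> y * (m ^ Suc n + real (Suc n) * m ^ n * (y - m))"
    using assms by simp
  also have "\<dots> \<le> y * y ^ Suc n"
    using Suc assms(1) by (rule mult_left_mono)
  finally show ?case by simp
qed

lemma set_integral_nonneg_real:
  fixes f :: "'a \<Rightarrow> real"
  assumes "\<And>x. x \<in> A \<Longrightarrow> 0 \<le> f x"
  shows "0 \<le> (LINT x:A|M. f x)"
  unfolding set_lebesgue_integral_def using assms
  by (intro Bochner_Integration.integral_nonneg) (simp add: indicator_def)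

text \<open>Jensen's inequality in unnormalised form. It follows from integrating the tangent bound
  at the mean value \<open>m\<close> of \<open>f\<close> over \<open>A\<close>, without any general
  theory of convex functions.\<close>

lemma power_set_integral_le:
  fixes f :: "'a \<Rightarrow> real"
  assumes A: "A \<in> sets M" "emeasure M A \<noteq> \<infinity>"
    and f: "set_integrable M A f" "\<And>x. x \<in> A \<Longrightarrow> 0 \<le> f x"
    and fp: "set_integrable M A (\<lambda>x. f x ^ Suc p)"
  shows "(LINT x:A|M. f x) ^ Suc p \<le> measure M A ^ p * (LINT x:A|M. f x ^ Suc p)"
proof -
  define L where "L = measure M A"
  define F where "F = (LINT x:A|M. f x)"
  define m where "m = F / L"
  have F0: "0 \<le> F"
    unfolding F_def using f(2) by (rule set_integral_nonneg_real)
  have const: "set_integrable M A (\<lambda>x. c)" for c :: real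
    using A by (simp add: set_integrable_def less_top)
  have const_eq: "(LINT x:A|M. c) = L * c" for c :: real
    using A by (simp add: set_integral_const L_def)
  show ?thesis
  \<comment> \<open>On a null set the mean is meaningless (\<open>m\<close> is 0 by the convention
    for division), but there \<open>F = 0\<close>, and the exponent \<open>Suc p\<close> is
    positive, so the left side vanishes.\<close>
  proof (cases "L = 0")
    case True
    then have "emeasure M A = 0"
      using A by (simp add: L_def emeasure_eq_ennreal_measure)
    then have "A \<in> null_sets M"
      using A(1) by blast
    from AE_not_in[OF this] have "F = 0"
      unfolding F_def set_lebesgue_integral_def
      by (intro integral_eq_zero_AE) (auto elim: eventually_mono)
    moreover have "0 \<le> (LINT x:A|M. f x ^ Suc p)"
      using f(2) by (intro set_integral_nonneg_real) simp
    ultimately show ?thesis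
      by (simp add: F_def)
  next
    case False
    then have L: "L > 0"
      by (simp add: L_def zero_less_measure_iff)
    then have m: "m \<ge> 0" "F = L * m"
      using F0 by (simp_all add: m_def)
    define c where "c = real (Suc p) * m ^ p"
    have "(LINT x:A|M. m ^ Suc p + c * (f x - m)) \<le> (LINT x:A|M. f x ^ Suc p)"
    proof (rule set_integral_mono)
      show "set_integrable M A (\<lambda>x. m ^ Suc p + c * (f x - m))"
        using f(1) const
        by (intro set_integral_add set_integrable_mult_right set_integral_diff)
      show "m ^ Suc p + c * (f x - m) \<le> f x ^ Suc p" if "x \<in> A" for x
        unfolding c_def using power_Suc_ge_tangent f(2)[OF that] m(1) by blast
    qed (rule fp)
    \<comment> \<open>The linear term integrates to \<open>c * (F - L * m) = 0\<close>; this is why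
      the tangent is taken at the mean.\<close>
    moreover have "(LINT x:A|M. m ^ Suc p + c * (f x - m)) = L * m ^ Suc p"
      using f(1) const m(2)
      by (simp add: set_integral_add set_integral_diff const_eq flip: F_def)
    \<comment> \<open>The factor \<open>L ^ p\<close> completes the left side to
      \<open>(L * m) ^ Suc p = F ^ Suc p\<close>.\<close>
    ultimately have "L ^ p * (L * m ^ Suc p) \<le> L ^ p * (LINT x:A|M. f x ^ Suc p)"
      using L by (intro mult_left_mono) auto
    then show ?thesis
      unfolding F_def[symmetric] L_def[symmetric] m(2) by (simp add: power_mult_distrib ac_simps)
  qed
qed

text \<open>Continuity from below of the measure with density \<open>g\<close>, along a sequence of
  left endpoints decreasing to \<open>a\<close>.\<close>

lemma nn_integral_greaterThanLessThan_le_SUP: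
  fixes a b :: real and g :: "real \<Rightarrow> ennreal"
  assumes "a < b" and g: "g \<in> borel_measurable lebesgue"
  shows "(\<integral>\<^sup>+x\<in>{a<..<b}. g x \<partial>lebesgue) \<le> (SUP y\<in>{a<..<b}. \<integral>\<^sup>+x\<in>{y<..<b}. g x \<partial>lebesgue)"
proof -
  \<comment> \<open>The shift by 2 keeps \<open>y n\<close> strictly below \<open>b\<close> already
    at \<open>n = 0\<close>.\<close>
  define y where "y n = a + (b - a) / real (n + 2)" for n :: nat
  have y: "y n \<in> {a<..<b}" for n
  proof -
    have "(b - a) / real (n + 2) < (b - a) / 1"
      using \<open>a < b\<close> by (intro divide_strict_left_mono) auto
    then show ?thesis
      using \<open>a < b\<close> by (simp add: y_def)
  qed
  have dec: "y n \<le> y m" if "m \<le> n" for m n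
    using \<open>a < b\<close> that by (auto simp: y_def intro!: divide_left_mono)
  have "y \<longlonglongrightarrow> a"
    unfolding y_def by real_asymp
  then have "\<exists>n. y n < x" if "a < x" for x
    using that order_tendstoD(2) eventually_happens sequentially_bot by blast
  then have U: "(\<Union>n. {y n<..<b}) = {a<..<b}"
    using y by (auto simp: set_eq_iff) (meson less_trans)
  have "(\<integral>\<^sup>+x\<in>{a<..<b}. g x \<partial>lebesgue) = emeasure (density lebesgue g) (\<Union>n. {y n<..<b})"
    using g by (simp add: U emeasure_density)
  also have "\<dots> = (SUP n. emeasure (density lebesgue g) {y n<..<b})"
    using dec by (intro SUP_emeasure_incseq[symmetric]) (force simp: incseq_def)+
  also have "\<dots> = (SUP n. \<integral>\<^sup>+x\<in>{y n<..<b}. g x \<partial>lebesgue)"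
    using g by (simp add: emeasure_density)
  also have "\<dots> \<le> (SUP y\<in>{a<..<b}. \<integral>\<^sup>+x\<in>{y<..<b}. g x \<partial>lebesgue)"
    using y by (intro SUP_mono) auto
  finally show ?thesis .
qed

lemma nn_set_integral_eq_set_integral:
  fixes f :: "'a \<Rightarrow> real"
  assumes "set_integrable M A f" "\<And>x. x \<in> A \<Longrightarrow> 0 \<le> f x"
  shows "ennreal (LINT x:A|M. f x) = (\<integral>\<^sup>+x\<in>A. ennreal (f x) \<partial>M)"
proof -
  have "(\<integral>\<^sup>+x. ennreal (indicator A x *\<^sub>R f x) \<partial>M) = ennreal (LINT x:A|M. f x)"
    unfolding set_lebesgue_integral_def
    using assms by (intro nn_integral_eq_integral) (auto simp: set_integrable_def indicator_def)
  moreover have "(\<integral>\<^sup>+x. ennreal (indicator A x *\<^sub>R f x) \<partial>M) = (\<integral>\<^sup>+x\<in>A. ennreal (f x) \<partial>M)"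
    by (intro nn_integral_cong) (simp add: indicator_def)
  ultimately show ?thesis by simp
qed

theorem theorem2p11:
  fixes a b :: real and r f :: "real \<Rightarrow> real" and p :: nat
  assumes "a < b"
    and "continuous_on {a<..<b} r"
    and "\<And>x. x \<in> {a<..<b} \<Longrightarrow> r x > 0"
    and "p > 0"
    and "f \<in> borel_measurable (lebesgue_on {a<..<b})"
    and "\<And>x. x \<in> {a<..<b} \<Longrightarrow> f x \<ge> 0"
    and "\<And>x. x \<in> {a<..<b} \<Longrightarrow> set_integrable lebesgue {a<..<x} f"
    and "\<And>x. x \<in> {a<..<b} \<Longrightarrow> set_integrable lebesgue {x<..<b} r"
    and "set_integrable lebesgue {a<..<b} (\<lambda>x. r x * (LINT t:{a<..<x}|lebesgue. f t) ^ (p + 1))"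
    and "set_integrable lebesgue {a<..<b} (\<lambda>x. f x ^ (p + 1))"
  shows "ennreal (LINT x:{a<..<b}|lebesgue. r x * (LINT t:{a<..<x}|lebesgue. f t) ^ (p + 1))
    \<le> ennreal ((b - a) ^ p)
        * (SUP x\<in>{a<..<b}. ennreal (LINT t:{x<..<b}|lebesgue. r t))
        * ennreal (LINT x:{a<..<b}|lebesgue. f x ^ (p + 1))"
proof -
  define I where "I = {a<..<b}"
  define F where "F x = (LINT t:{a<..<x}|lebesgue. f t)" for x
  define K where "K = (b - a) ^ p * (LINT x:I|lebesgue. f x ^ (p + 1))"
  note f0 = assms(6) and r0 = assms(3)
  have F0: "0 \<le> F x" if "x \<in> I" for x
    unfolding F_def using f0 that by (intro set_integral_nonneg_real) (auto simp: I_def)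
  have J0: "0 \<le> (LINT x:I|lebesgue. f x ^ (p + 1))"
    using f0 by (intro set_integral_nonneg_real) (auto simp: I_def)
  \<comment> \<open>Jensen on \<open>{a<..<x}\<close>, after which both the length and the integral
    of \<open>f ^ (p + 1)\<close> grow when \<open>x\<close> is replaced by
    \<open>b\<close>.\<close>
  have FK: "F x ^ (p + 1) \<le> K" if x: "x \<in> I" for x
  proof -
    have sub: "{a<..<x} \<subseteq> I"
      using x by (auto simp: I_def)
    have fp: "set_integrable lebesgue {a<..<x} (\<lambda>t. f t ^ (p + 1))"
      by (rule set_integrable_subset[OF assms(10)]) (use sub in \<open>auto simp: I_def\<close>)
    have "F x ^ (p + 1) \<le> measure lebesgue {a<..<x} ^ p * (LINT t:{a<..<x}|lebesgue. f t ^ (p + 1))"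
      using power_set_integral_le[of "{a<..<x}" lebesgue f p] assms(7) fp f0 x
      by (auto simp: F_def I_def)
    also have "\<dots> \<le> (b - a) ^ p * (LINT t:I|lebesgue. f t ^ (p + 1))"
    proof (intro mult_mono power_mono)
      show "(LINT t:{a<..<x}|lebesgue. f t ^ (p + 1)) \<le> (LINT t:I|lebesgue. f t ^ (p + 1))"
        using f0 fp assms(10) sub unfolding set_lebesgue_integral_def set_integrable_def I_def
        by (intro integral_mono) (auto simp: indicator_def)
      show "0 \<le> (LINT t:{a<..<x}|lebesgue. f t ^ (p + 1))"
        using f0 x by (intro set_integral_nonneg_real) (auto simp: I_def)
    qed (use x in \<open>auto simp: I_def\<close>)
    finally show ?thesis by (simp add: K_def)
  qed
  \<comment> \<open>Nothing is known about \<open>r\<close> outside \<open>I\<close>, so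
    measurability is available only for \<open>r\<close> cut off by the indicator of
    \<open>I\<close>.\<close>
  have "(\<lambda>x. indicator I x *\<^sub>R r x) \<in> borel_measurable borel"
    using assms(2) unfolding I_def by (intro borel_measurable_continuous_on_indicator) auto
  then have "(\<lambda>x. ennreal (indicator I x *\<^sub>R r x)) \<in> borel_measurable lebesgue"
    by (intro measurable_compose[OF _ measurable_ennreal] measurable_completion) simp
  also have "(\<lambda>x. ennreal (indicator I x *\<^sub>R r x)) = (\<lambda>x. ennreal (r x) * indicator I x)"
    by (auto simp: indicator_def)
  finally have rmeas: "(\<lambda>x. ennreal (r x) * indicator I x) \<in> borel_measurable lebesgue" .
  have "ennreal (LINT x:I|lebesgue. r x * F x ^ (p + 1))
      = (\<integral>\<^sup>+x\<in>I. ennreal (r x * F x ^ (p + 1)) \<partial>lebesgue)"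
    using assms(9) r0 F0 by (intro nn_set_integral_eq_set_integral) (auto simp: I_def F_def less_imp_le)
  also have "\<dots> \<le> (\<integral>\<^sup>+x. ennreal K * (ennreal (r x) * indicator I x) \<partial>lebesgue)"
  proof (rule nn_integral_mono)
    fix x
    \<comment> \<open>The chain \<open>0 \<le> F x ^ (p + 1) \<le> K\<close> also gives
      \<open>0 \<le> K\<close>, so that \<open>ennreal\<close> is multiplicative here.\<close>
    have "ennreal (r x * F x ^ (p + 1)) \<le> ennreal K * ennreal (r x)" if "x \<in> I"
      using mult_left_mono[OF FK[OF that], of "r x"] r0[of x] that
        order_trans[OF zero_le_power[OF F0[OF that]] FK[OF that]]
      by (simp add: I_def mult.commute less_imp_le flip: ennreal_mult)
    then show "ennreal (r x * F x ^ (p + 1)) * indicator I x \<le> ennreal K * (ennreal (r x) * indicator I x)"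
      by (auto simp: indicator_def)
  qed
  also have "\<dots> = ennreal K * (\<integral>\<^sup>+x\<in>I. ennreal (r x) \<partial>lebesgue)"
    using rmeas by (rule nn_integral_cmult)
  also have "(\<integral>\<^sup>+x\<in>I. ennreal (r x) \<partial>lebesgue)
      \<le> (SUP y\<in>I. \<integral>\<^sup>+x\<in>{y<..<b}. ennreal (r x) * indicator I x \<partial>lebesgue)"
    using nn_integral_greaterThanLessThan_le_SUP[OF assms(1) rmeas]
    by (simp add: I_def mult.assoc flip: indicator_inter_arith)
  \<comment> \<open>Since \<open>{y<..<b}\<close> lies inside \<open>I\<close>, the cut-off
    disappears. There \<open>r\<close> is integrable, so each term is again a real integral,
    although their supremum may be infinite.\<close>
  also have "\<dots> = (SUP y\<in>I. ennreal (LINT t:{y<..<b}|lebesgue. r t))"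
  proof (intro SUP_cong refl)
    fix y assume y: "y \<in> I"
    have "ennreal (LINT t:{y<..<b}|lebesgue. r t) = (\<integral>\<^sup>+x\<in>{y<..<b}. ennreal (r x) \<partial>lebesgue)"
      using assms(8) r0 y by (intro nn_set_integral_eq_set_integral) (auto simp: I_def less_imp_le)
    also have "\<dots> = (\<integral>\<^sup>+x\<in>{y<..<b}. ennreal (r x) * indicator I x \<partial>lebesgue)"
      using y by (intro nn_integral_cong) (auto simp: I_def indicator_def)
    finally show "(\<integral>\<^sup>+x\<in>{y<..<b}. ennreal (r x) * indicator I x \<partial>lebesgue)
        = ennreal (LINT t:{y<..<b}|lebesgue. r t)" by simp
  qed
  finally have "ennreal (LINT x:I|lebesgue. r x * F x ^ (p + 1))
      \<le> ennreal K * (SUP y\<in>I. ennreal (LINT t:{y<..<b}|lebesgue. r t))"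
    by (simp add: mult_left_mono)
  also have "ennreal K = ennreal ((b - a) ^ p) * ennreal (LINT x:I|lebesgue. f x ^ (p + 1))"
    unfolding K_def using assms(1) J0 by (intro ennreal_mult) auto
  finally show ?thesis
    by (simp add: I_def F_def ac_simps)
qed

end
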